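(* If $D$ is any oriented graph, then $\chi_A(D) \leq \left\lfloor \frac{2}{5}\cdot(\Delta(D)+1) \right\rfloor + 1$.
   Context: Digraphs are finite, nonempty, without loops and without parallel edges in the same direction. An oriented graph is a digraph in which at most one edge connects any pair of vertices (so there are no directed 2-cycles). $\Delta(D)$ is the maximum total degree (in-degree plus out-degree) of a vertex of $D$. An acyclic set in a digraph is a set of vertices whose induced subgraph contains no directed cycle. $\chi_A(D)$, the digraph chromatic number, is the minimum number of acyclic sets into which $V(D)$ can be partitioned. *)

theory Defs
  imports Complex_Main "HOL-Library.Disjoint_Sets" "Graph_Theory.Graph_Theory"
begin

text \<open>
  The locale \<^locale>\<open>digraph\<close> gives finite digraphs without loops and without parallel arcs in
  the same direction; it allows the null graph, so nonemptiness is added here.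
\<close>

locale oriented_graph = digraph G for G :: "('a, 'b) pre_digraph" (structure) +
  assumes verts_nonempty: "verts G \<noteq> {}"
    and at_most_one_arc:
      "\<lbrakk>e1 \<in> arcs G; e2 \<in> arcs G; {tail G e1, head G e1} = {tail G e2, head G e2}\<rbrakk> \<Longrightarrow> e1 = e2"

definition max_total_degree :: "('a, 'b) pre_digraph \<Rightarrow> nat" where
  "max_total_degree G = Max ((\<lambda>v. in_degree G v + out_degree G v) ` verts G)"

definition acyclic_set :: "('a, 'b) pre_digraph \<Rightarrow> 'a set \<Rightarrow> bool" where
  "acyclic_set G S \<longleftrightarrow> S \<subseteq> verts G \<and> \<not> (\<exists>p. pre_digraph.cycle (G \<restriction> S) p)"

definition acyclic_partition :: "('a, 'b) pre_digraph \<Rightarrow> 'a set set \<Rightarrow> bool" where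
  "acyclic_partition G P \<longleftrightarrow> partition_on (verts G) P \<and> (\<forall>S\<in>P. acyclic_set G S)"

definition digraph_chromatic_number :: "('a, 'b) pre_digraph \<Rightarrow> nat" where
  "digraph_chromatic_number G = (LEAST k. \<exists>P. acyclic_partition G P \<and> finite P \<and> card P = k)"

lemma (in digraph) acyclic_partition_singletons:
  "acyclic_partition G ((\<lambda>v. {v}) ` verts G)"
proof -
  have "\<not> pre_digraph.cycle (G \<restriction> {v}) p" for v p
  proof
    assume c: "pre_digraph.cycle (G \<restriction> {v}) p"
    then obtain u where u: "pre_digraph.awalk (G \<restriction> {v}) u p u" and "p \<noteq> []"
      unfolding pre_digraph.cycle_def by blast
    then have "hd p \<in> arcs (G \<restriction> {v})"
      unfolding pre_digraph.awalk_def using hd_in_set by blast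
    then have "hd p \<in> arcs G" "tail G (hd p) = head G (hd p)"
      by auto
    then show False using no_loops by blast
  qed
  then show ?thesis
    unfolding acyclic_partition_def acyclic_set_def
    by (auto simp: partition_on_def disjoint_def)
qed

text \<open>The minimum defining the chromatic number is over a nonempty set, hence attained.\<close>

lemma (in digraph) digraph_chromatic_number_attained:
  "\<exists>P. acyclic_partition G P \<and> finite P \<and> card P = digraph_chromatic_number G"
  unfolding digraph_chromatic_number_def
  by (rule LeastI_ex) (use acyclic_partition_singletons finite_verts in blast)

end

theory Submission
  imports Defs
begin

text \<open>
  A set in which every vertex has total degree at most 4 is covered by two colours, so five units of
  degree cost two colours. Lovasz's degree splitting (\<open>degree_split\<close>) turns this into the bound: if
  all total degrees are less than \<open>n\<close> and \<open>n > 5\<close>, then the vertex set splits into a part with degrees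
  less than 5 and a part with degrees less than \<open>n - 5\<close>, and induction on \<open>n\<close> gives
  \<open>2 * n div 5 + 1\<close> colours. Of the remaining cases, degrees less than 2 leave no cycle at all, and
  \<open>3 \<le> n \<le> 5\<close> is the two-colour result again.

  The two-colour result (\<open>acyclic_two_colouring_if_degree_le_4\<close>) is a case of Brooks' theorem for
  digraphs, proved here by local recolouring alone. In a minimal counterexample all vertices except
  one, the hole, can be coloured. Neither colour is possible at the hole, so it has exactly one
  in-neighbour and one out-neighbour of each colour. The hole can therefore move to an out-neighbour
  \<open>u\<close>: the old hole takes the colour of \<open>u\<close>, and no new cycle arises because the old hole has lost
  its only out-neighbour of that colour. Let the hole walk in this way, following alternately the two
  colours, until it first returns to an earlier position. Comparing the colours then with those at
  the earlier time shows that the number \<open>t\<close> of steps between the visits is odd, that the walk goes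
  round the same directed cycle of length \<open>t\<close> ever after, and that the second out-neighbour of each
  vertex of the cycle lies on the cycle an even number \<open>p\<close> of steps ahead, where \<open>2 \<le> p \<le> t - 3\<close>
  (\<open>first_return_structure\<close>).

  So, up to rotation, the situation is a directed cycle \<open>0, 1, \<dots>, t - 1\<close> whose chords all go an even
  number of steps ahead, with the hole at 0 and colours alternating along \<open>1, \<dots>, t - 1\<close>. Now move the
  hole along the chord from 0 to \<open>p\<close>. The colour of the odd positions must contain a path from
  \<open>p + 1\<close> to \<open>p - 1\<close>, since these are the neighbours of the hole in that colour. But an edge from an
  odd position to an odd position is a chord that does not pass 0, so it increases the position, and
  \<open>p - 1\<close> is out of reach (\<open>walk_impossible\<close>).
\<close>


section \<open>Acyclic colourings of relations\<close>

definition degree_in :: "'a rel \<Rightarrow> 'a set \<Rightarrow> 'a \<Rightarrow> nat" where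
  "degree_in E S v = card (S \<inter> E `` {v}) + card (S \<inter> E\<inverse> `` {v})"

definition acyclic_colouring :: "'a rel \<Rightarrow> 'a set \<Rightarrow> ('a \<Rightarrow> 'c) \<Rightarrow> bool" where
  "acyclic_colouring E S c \<longleftrightarrow> (\<forall>i. acyclic (Restr E {v \<in> S. c v = i}))"

definition acyclically_colourable :: "'a rel \<Rightarrow> 'a set \<Rightarrow> nat \<Rightarrow> bool" where
  "acyclically_colourable E S k \<longleftrightarrow> (\<exists>c. c ` S \<subseteq> {..<k} \<and> acyclic_colouring E S c)"

lemma acyclic_Restr_subset:
  "acyclic (Restr E T) \<Longrightarrow> S \<subseteq> T \<Longrightarrow> acyclic (Restr E S)"
  by (erule acyclic_subset) auto

lemma acyclic_colouring_class:
  assumes "acyclic_colouring E V c" "S \<subseteq> {v \<in> V. c v = i}"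
  shows "acyclic (Restr E S)"
  using assms(1) unfolding acyclic_colouring_def by (intro acyclic_Restr_subset[OF _ assms(2)]) blast

lemma degree_in_mono:
  assumes "finite T" "S \<subseteq> T"
  shows "degree_in E S v \<le> degree_in E T v"
  unfolding degree_in_def using assms by (intro add_mono card_mono) auto

lemma degree_in_disjoint_Un:
  assumes "finite S" "finite T" "S \<inter> T = {}"
  shows "degree_in E (S \<union> T) v = degree_in E S v + degree_in E T v"
proof -
  have "card ((S \<union> T) \<inter> X) = card (S \<inter> X) + card (T \<inter> X)" for X
    using assms by (subst card_Un_disjoint[symmetric]) (auto simp: Int_Un_distrib2)
  then show ?thesis by (simp add: degree_in_def)
qed

text \<open>
  Adding \<open>h\<close> can only create cycles through \<open>h\<close>; removing \<open>h\<close> from such a cycle leaves the path.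
\<close>
lemma returning_path_if_not_acyclic_insert:
  assumes ac: "acyclic (Restr E S)" and nac: "\<not> acyclic (Restr E (insert h S))"
    and h: "h \<notin> S" "(h, h) \<notin> E"
  shows "\<exists>a\<in>S. \<exists>b\<in>S. (h, a) \<in> E \<and> (b, h) \<in> E \<and> (a, b) \<in> (Restr E S)\<^sup>*"
proof (rule ccontr)
  let ?R = "Restr E S" and ?R' = "Restr E (insert h S)"
  assume no: "\<not> ?thesis"
  have stay: "y \<in> S" if "(a, y) \<in> ?R\<^sup>*" "a \<in> S" for a y
    using that by (induction rule: rtrancl_induct) auto
  \<comment> \<open>Under \<open>no\<close>, a path that leaves \<open>h\<close> never meets \<open>h\<close> again and runs inside \<open>S\<close> from then on.\<close>
  have "\<exists>a\<in>S. (h, a) \<in> E \<and> (a, y) \<in> ?R\<^sup>*" if "(h, y) \<in> ?R'\<^sup>+" for y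
    using that
  proof (induction rule: trancl_induct)
    case (base y)
    then show ?case using h by auto
  next
    case (step y z)
    then obtain a where a: "a \<in> S" "(h, a) \<in> E" "(a, y) \<in> ?R\<^sup>*" by blast
    then have "y \<in> S" using stay by blast
    then have "(y, z) \<in> ?R" using step(2) no a by blast
    then show ?case using a by (meson rtrancl.rtrancl_into_rtrancl)
  qed
  then have hh: "(h, h) \<notin> ?R'\<^sup>+" using stay h by blast
  have "(x, y) \<in> ?R\<^sup>+ \<or> ((x, h) \<in> ?R'\<^sup>* \<and> (h, y) \<in> ?R'\<^sup>*)" if "(x, y) \<in> ?R'\<^sup>+" for x y
    using that
  proof (induction rule: trancl_induct)
    case (base y)
    then show ?case by (cases "x = h \<or> y = h") auto
  next
    case (step y z)
    then consider "(x, y) \<in> ?R\<^sup>+" | "(x, h) \<in> ?R'\<^sup>*" "(h, z) \<in> ?R'\<^sup>*"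
      by (meson rtrancl.rtrancl_into_rtrancl)
    then show ?case
    proof cases
      case 1
      then have "y \<in> S" by (induction rule: trancl_induct) auto
      show ?thesis
      proof (cases "z = h")
        case True
        moreover have "(x, z) \<in> ?R'\<^sup>+"
          using step(1,2) by (rule trancl.trancl_into_trancl)
        ultimately show ?thesis by (simp add: trancl_into_rtrancl)
      next
        case False
        then have "(y, z) \<in> ?R" using step(2) \<open>y \<in> S\<close> by auto
        then show ?thesis using 1 by (meson trancl.trancl_into_trancl)
      qed
    qed auto
  qed
  then have "(x, x) \<notin> ?R'\<^sup>+" for x
    using ac hh unfolding acyclic_def
    by (metis rtranclD rtrancl_trancl_trancl)
  then show False using nac unfolding acyclic_def by blast
qed


section \<open>Two colours for total degree at most four\<close>

text \<open>
  The whole locale is a proof by contradiction: no such \<open>E\<close> and \<open>V\<close> exist. Minimality of the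
  counterexample enters only later, as the existence of a hole.
\<close>
locale uncolourable_oriented =
  fixes E :: "'a rel" and V :: "'a set"
  assumes finite_V: "finite V"
    and oriented: "(u, v) \<in> E \<Longrightarrow> (v, u) \<notin> E"
    and degree_le_4: "v \<in> V \<Longrightarrow> degree_in E V v \<le> 4"
    and not_colourable: "\<not> acyclic_colouring E V (c :: 'a \<Rightarrow> bool)"
begin

text \<open>
  The colouring is a total function, and its value at the hole itself carries no meaning. Moving the
  hole is then a single function update.
\<close>
definition hole :: "'a \<Rightarrow> ('a \<Rightarrow> bool) \<Rightarrow> bool" where
  "hole h c \<longleftrightarrow> h \<in> V \<and> acyclic_colouring E (V - {h}) c"

lemma hole_acyclic:
  "hole h c \<Longrightarrow> acyclic (Restr E {v \<in> V - {h}. c v = s})"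
  by (simp add: hole_def acyclic_colouring_def)

text \<open>
  Giving the hole the colour \<open>s\<close> does not colour \<open>V\<close>, so it closes a cycle of colour \<open>s\<close>.
\<close>
lemma hole_path:
  assumes "hole h c"
  obtains a b where "a \<in> V" "b \<in> V" "(h, a) \<in> E" "(b, h) \<in> E" "c a = s" "c b = s"
    "(a, b) \<in> (Restr E {v \<in> V - {h}. c v = s})\<^sup>*"
proof -
  let ?S = "\<lambda>s. {v \<in> V - {h}. c v = s}"
  have ac: "acyclic (Restr E (?S i))" for i
    using assms by (auto simp: hole_def acyclic_colouring_def)
  have hV: "h \<in> V" using assms by (simp add: hole_def)
  have "\<not> acyclic_colouring E V (c(h := s))" by (rule not_colourable)
  then obtain i where i: "\<not> acyclic (Restr E {v \<in> V. (c(h := s)) v = i})"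
    unfolding acyclic_colouring_def by blast
  have "i = s"
  proof (rule ccontr)
    assume "i \<noteq> s"
    then have "{v \<in> V. (c(h := s)) v = i} = ?S i" by auto
    then show False using i ac by simp
  qed
  moreover have "{v \<in> V. (c(h := s)) v = s} = insert h (?S s)" using hV by auto
  ultimately have "\<not> acyclic (Restr E (insert h (?S s)))" using i by simp
  from returning_path_if_not_acyclic_insert[OF ac this] oriented
  obtain a b where "a \<in> ?S s" "b \<in> ?S s" "(h, a) \<in> E" "(b, h) \<in> E" "(a, b) \<in> (Restr E (?S s))\<^sup>*"
    by blast
  then show ?thesis using that by blast
qed

text \<open>
  By \<open>hole_path\<close> the hole has an in-neighbour and an out-neighbour in each of the two colours. This
  already accounts for total degree 4, so there is no room for a second one of the same kind.
\<close>
lemma hole_neighbours_unique: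
  assumes "hole h c"
  shows "u \<in> V \<Longrightarrow> w \<in> V \<Longrightarrow> (h, u) \<in> E \<Longrightarrow> (h, w) \<in> E \<Longrightarrow> c u = c w \<Longrightarrow> u = w"
    and "u \<in> V \<Longrightarrow> w \<in> V \<Longrightarrow> (u, h) \<in> E \<Longrightarrow> (w, h) \<in> E \<Longrightarrow> c u = c w \<Longrightarrow> u = w"
proof -
  define Out where "Out s = {v \<in> V. (h, v) \<in> E \<and> c v = s}" for s
  define In where "In s = {v \<in> V. (v, h) \<in> E \<and> c v = s}" for s
  have fin: "finite (Out s)" "finite (In s)" for s
    using finite_V by (auto simp: Out_def In_def)
  have "Out s \<noteq> {} \<and> In s \<noteq> {}" for s
    using hole_path[OF assms, of s] unfolding Out_def In_def by blast
  then have ge: "card (Out s) \<ge> 1" "card (In s) \<ge> 1" for s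
    using fin by (simp_all add: Suc_leI card_gt_0_iff)
  have "V \<inter> E `` {h} = Out True \<union> Out False" "Out True \<inter> Out False = {}"
    "V \<inter> E\<inverse> `` {h} = In True \<union> In False" "In True \<inter> In False = {}"
    by (auto simp: Out_def In_def)
  then have "degree_in E V h = card (Out True) + card (Out False) + (card (In True) + card (In False))"
    unfolding degree_in_def using fin by (simp add: card_Un_disjoint)
  moreover have "degree_in E V h \<le> 4" using assms degree_le_4 by (simp add: hole_def)
  ultimately have "card (Out s) \<le> 1 \<and> card (In s) \<le> 1" for s
    using ge[of True] ge[of False] by (cases s) auto
  then have uniq: "x = y" if "x \<in> Out s \<and> y \<in> Out s \<or> x \<in> In s \<and> y \<in> In s" for x y s
    using that fin by (metis One_nat_def card_le_Suc0_iff_eq)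
  show "u \<in> V \<Longrightarrow> w \<in> V \<Longrightarrow> (h, u) \<in> E \<Longrightarrow> (h, w) \<in> E \<Longrightarrow> c u = c w \<Longrightarrow> u = w"
    using uniq[of u "c u" w] by (simp add: Out_def)
  show "u \<in> V \<Longrightarrow> w \<in> V \<Longrightarrow> (u, h) \<in> E \<Longrightarrow> (w, h) \<in> E \<Longrightarrow> c u = c w \<Longrightarrow> u = w"
    using uniq[of u "c u" w] by (simp add: In_def)
qed

text \<open>
  The vertex \<open>u\<close> was the only out-neighbour of \<open>h\<close> in its colour. Once \<open>u\<close> is uncoloured, \<open>h\<close> has no
  out-neighbour left in that colour and can take it without closing a cycle.
\<close>
lemma hole_move:
  assumes hole: "hole h c" and u: "u \<in> V" "(h, u) \<in> E"
  shows "hole u (c(h := c u))"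
proof -
  have "acyclic (Restr E {v \<in> V - {u}. (c(h := c u)) v = i})" for i
  proof (cases "i = c u")
    case False
    then have "{v \<in> V - {u}. (c(h := c u)) v = i} \<subseteq> {v \<in> V - {h}. c v = i}" by auto
    with hole_acyclic[OF hole] show ?thesis by (rule acyclic_Restr_subset)
  next
    case True
    let ?S = "{v \<in> V - {h, u}. c v = i}"
    have "acyclic (Restr E ?S)"
      using hole_acyclic[OF hole, of i] by (rule acyclic_Restr_subset) auto
    moreover have "(h, a) \<notin> E" if "a \<in> ?S" for a
      using hole_neighbours_unique(1)[OF hole, of u a] u that True by auto
    moreover have "(h, h) \<notin> E" using oriented by blast
    ultimately have "acyclic (Restr E (insert h ?S))"
      using returning_path_if_not_acyclic_insert[of E ?S h] by blast
    then show ?thesis by (rule acyclic_Restr_subset) auto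
  qed
  then show ?thesis using u by (simp add: hole_def acyclic_colouring_def)
qed

end

text \<open>
  Step \<open>n\<close> of the walk follows the colour \<open>even n\<close>, so \<open>h n\<close> keeps this colour until the hole comes
  back to it: the colour of a visited vertex is the parity of its last visit.
\<close>
locale alternating_hole_walk = uncolourable_oriented E V
  for E :: "'a rel" and V :: "'a set" +
  fixes h :: "nat \<Rightarrow> 'a" and c :: "nat \<Rightarrow> 'a \<Rightarrow> bool"
  assumes walk_hole: "hole (h n) (c n)"
    and walk_edge: "(h n, h (Suc n)) \<in> E"
    and walk_colour: "c n (h (Suc n)) = even n"
    and walk_recolour: "c (Suc n) = (c n)(h n := even n)"
begin

lemma h_in_V: "h n \<in> V"
  using walk_hole by (simp add: hole_def)

lemma colour_if_not_visited:
  assumes "i \<le> n" "\<And>m. i \<le> m \<Longrightarrow> m < n \<Longrightarrow> h m \<noteq> z"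
  shows "c n z = c i z"
  using assms
proof (induction n rule: dec_induct)
  case base
  then show ?case by simp
next
  case (step n)
  then have "c n z = c i z" by (meson less_SucI)
  then show ?case using step.prems[of n] step.hyps by (auto simp: walk_recolour)
qed

lemma colour_of_last_visit:
  assumes "m < n" "\<And>k. m < k \<Longrightarrow> k < n \<Longrightarrow> h k \<noteq> h m"
  shows "c n (h m) = even m"
proof -
  have "c n (h m) = c (Suc m) (h m)"
    using assms by (intro colour_if_not_visited) auto
  then show ?thesis by (simp add: walk_recolour)
qed

definition first_return :: "nat \<Rightarrow> nat \<Rightarrow> bool" where
  "first_return i t \<longleftrightarrow> 0 < t \<and> h (i + t) = h i \<and> inj_on h {i..<i + t}"

text \<open>
  In a finite set some vertex is visited twice; two visits to a common vertex at the least possible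
  distance have no repetition in between.
\<close>
lemma first_return_exists: "\<exists>i t. first_return i t"
proof -
  define P where "P t \<longleftrightarrow> 0 < t \<and> (\<exists>i. h (i + t) = h i)" for t
  have "\<not> inj h"
    using h_in_V finite_V by (meson finite_imageD finite_subset image_subsetI infinite_UNIV_nat)
  then obtain x y where xy: "h x = h y" "x < y"
    unfolding inj_def by (metis linorder_neqE_nat)
  then have "P (y - x)" unfolding P_def by (intro conjI exI[of _ x]) auto
  then have PL: "P (LEAST t. P t)" by (rule LeastI)
  then obtain i where i: "h (i + (LEAST t. P t)) = h i" unfolding P_def by blast
  have "inj_on h {i..<i + (LEAST t. P t)}"
  proof (rule linorder_inj_onI)
    fix x y assume xy: "x < y" "x \<in> {i..<i + (LEAST t. P t)}" "y \<in> {i..<i + (LEAST t. P t)}"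
    then have "\<not> P (y - x)" by (intro not_less_Least) auto
    then show "h x \<noteq> h y" using xy unfolding P_def by (metis le_add_diff_inverse less_imp_le zero_less_diff)
  qed auto
  then have "first_return i (LEAST t. P t)"
    using PL i by (simp add: first_return_def P_def)
  then show ?thesis by blast
qed

lemma first_return_colour:
  assumes "first_return i t" "i \<le> m" "m < i + t"
  shows "c (i + t) (h m) = even m"
proof (rule colour_of_last_visit)
  fix k assume "m < k" "k < i + t"
  then show "h k \<noteq> h m"
    using assms unfolding first_return_def by (auto dest: inj_onD)
qed (use assms in auto)

text \<open>
  At time \<open>i + t\<close> the hole is back at \<open>h i\<close>, and the colours of its two out-neighbours are compared
  with those at time \<open>i\<close>. The successor \<open>h (i + 1)\<close> has meanwhile changed its colour. As the two
  out-neighbours have different colours whenever the hole is at \<open>h i\<close>, the other one must have changed its colour too, so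
  the walk has visited it, and the parity of that visit is known from its new colour.
\<close>
lemma first_return_structure:
  assumes r: "first_return i t"
  shows "odd t" and "h (Suc (i + t)) = h (Suc i)"
    and "\<exists>p. even p \<and> 2 \<le> p \<and> p + 3 \<le> t \<and> (h i, h (i + p)) \<in> E \<and>
          (\<forall>u\<in>V. (h i, u) \<in> E \<longrightarrow> u = h (Suc i) \<or> u = h (i + p))"
proof -
  let ?N = "i + t"
  have ht: "h ?N = h i" and t0: "0 < t" and inj: "inj_on h {i..<?N}"
    using r by (auto simp: first_return_def)
  have noloop: "(x, x) \<notin> E" for x using oriented by blast
  have "t \<noteq> 1" using ht walk_edge[of i] noloop by auto
  then have t2: "2 \<le> t" using t0 by linarith
  have pre: "Suc (?N - 1) = ?N" using t0 by auto
  \<comment> \<open>The last step into \<open>h i\<close> follows the colour that \<open>h i\<close> received when the hole left it.\<close>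
  have "c (?N - 1) (h i) = even i"
  proof (rule colour_of_last_visit)
    show "i < ?N - 1" using t2 by auto
    fix k assume "i < k" "k < ?N - 1"
    then show "h k \<noteq> h i" using inj by (auto dest: inj_onD)
  qed
  moreover have "c (?N - 1) (h i) = even (?N - 1)"
    using walk_colour[of "?N - 1"] pre ht by simp
  ultimately show odd: "odd t" using t2 by (auto simp: even_diff_nat)
  have hole: "hole (h i) (c ?N)" using walk_hole[of ?N] ht by simp
  have c1: "c ?N (h (Suc i)) = even (Suc i)"
    using first_return_colour[OF r, of "Suc i"] t2 by simp
  have e1: "(h i, h (Suc i)) \<in> E" by (rule walk_edge)
  have "(h i, h (Suc ?N)) \<in> E" "c ?N (h (Suc ?N)) = even ?N"
    using walk_edge[of ?N] walk_colour[of ?N] ht by auto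
  then show "h (Suc ?N) = h (Suc i)"
    using hole_neighbours_unique(1)[OF hole h_in_V h_in_V] e1 c1 odd by simp
  obtain z where z: "z \<in> V" "(h i, z) \<in> E" "c ?N z = even i"
    by (rule hole_path[OF hole, of "even i"])
  have "z \<noteq> h (Suc i)" using z c1 by auto
  \<comment> \<open>Only the walk changes colours, so a vertex whose colour differs at the two times was visited.\<close>
  then have "c i z \<noteq> c i (h (Suc i))"
    using hole_neighbours_unique(1)[OF walk_hole[of i], of z "h (Suc i)"] z e1 h_in_V by auto
  then have "c i z \<noteq> even i" using walk_colour[of i] by simp
  then have "\<exists>m\<ge>i. m < ?N \<and> h m = z"
    using z(3) colour_if_not_visited[of i ?N z] by (metis le_add1)
  then obtain p where p: "p < t" "z = h (i + p)"
    by (metis add_less_cancel_left le_iff_add)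
  have "even p" using first_return_colour[OF r, of "i + p"] p z(3) by auto
  moreover have "p \<noteq> 0"
  proof
    assume "p = 0"
    then show False using p z noloop by auto
  qed
  \<comment> \<open>The vertex visited last before the return is an in-neighbour of \<open>h i\<close>.\<close>
  moreover have "p \<noteq> t - 1"
  proof
    assume "p = t - 1"
    then have "(z, h i) \<in> E" using walk_edge[of "i + p"] p ht t0 by simp
    then show False using z oriented by blast
  qed
  moreover have "p \<noteq> t - 2" using \<open>even p\<close> odd t2 by auto
  ultimately have "even p" "2 \<le> p" "p + 3 \<le> t" using p odd by (auto elim!: evenE)
  moreover have "u = h (Suc i) \<or> u = h (i + p)" if "u \<in> V" "(h i, u) \<in> E" for u
  proof (cases "c ?N u = even i")
    case True
    then show ?thesis
      using hole_neighbours_unique(1)[OF hole, of u z] z that p by auto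
  next
    case False
    then have "c ?N u = c ?N (h (Suc i))" using c1 by simp
    then show ?thesis
      using hole_neighbours_unique(1)[OF hole, of u "h (Suc i)"] e1 that h_in_V by auto
  qed
  ultimately show "\<exists>p. even p \<and> 2 \<le> p \<and> p + 3 \<le> t \<and> (h i, h (i + p)) \<in> E \<and>
          (\<forall>u\<in>V. (h i, u) \<in> E \<longrightarrow> u = h (Suc i) \<or> u = h (i + p))"
    using z p by blast
qed

text \<open>
  The walk leaves \<open>h i\<close> the second time as it did the first time. So the return property moves on to
  \<open>i + 1\<close>, and inductively the walk is periodic from time \<open>i\<close> on.
\<close>
lemma first_return_Suc:
  assumes r: "first_return i t"
  shows "first_return (Suc i) t"
proof -
  have t: "0 < t" and ht: "h (i + t) = h i" and inj: "inj_on h {i..<i + t}"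
    using r by (auto simp: first_return_def)
  have "{i..<i + t} = insert i {Suc i..<i + t}" using t by auto
  then have "inj_on h (insert (i + t) {Suc i..<i + t})"
    using inj ht by (auto simp: inj_on_insert)
  moreover have "{Suc i..<Suc i + t} = insert (i + t) {Suc i..<i + t}" using t by auto
  ultimately show ?thesis
    using t first_return_structure(2)[OF r] by (simp add: first_return_def)
qed

text \<open>
  The contradiction comes from leaving the cycle: at a time \<open>N\<close> when the hole has gone round once, it
  is moved along its chord instead, to \<open>h (N + p)\<close>. Relative to \<open>N\<close>, the odd positions form the part
  of the cycle with colour \<open>even N\<close>. In this colour only positive even steps that do not pass \<open>h N\<close>
  are possible, which rules out the path demanded by \<open>hole_path\<close>.
\<close>
lemma walk_impossible: False
proof -
  obtain i t where it: "first_return i t" using first_return_exists by blast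
  have r: "first_return (i + n) t" for n
    by (induction n) (use it first_return_Suc in auto)
  define N where "N = i + t"
  have rN: "first_return (N + n) t" for n
    using r[of "t + n"] by (simp add: N_def add.assoc)
  have odd: "odd t" by (rule first_return_structure(1)[OF it])
  have period: "h (N + n + t) = h (N + n)" for n
    using rN[of n] by (simp add: first_return_def)
  have dist: "inj_on h {N..<N + t}"
    using rN[of 0] by (simp add: first_return_def)
  \<comment> \<open>The last visit to \<open>h (N + k)\<close> before \<open>N\<close> was at \<open>N + k - t\<close>, of the opposite parity as \<open>t\<close> is odd.\<close>
  have col: "c N (h (N + k)) = odd (N + k)" if "0 < k" "k < t" for k
  proof -
    have "h (N + k) = h (i + k)"
      using r[of k] by (simp add: first_return_def N_def add_ac)
    then show ?thesis
      using first_return_colour[OF it, of "i + k"] that odd by (simp add: N_def)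
  qed
  obtain p where p: "even p" "2 \<le> p" "p + 3 \<le> t" "(h N, h (N + p)) \<in> E"
    using first_return_structure(3)[OF rN[of 0]] by auto
  let ?g = "h (N + p)" and ?c = "(c N)(h N := odd N)"
  have colp: "c N ?g = odd N" using col[of p] p by simp
  have hole: "hole ?g ?c"
    using hole_move[OF walk_hole[of N] h_in_V p(4)] colp by simp
  have neq: "h (N + k) \<noteq> h N" if "0 < k" "k < t" for k
    using inj_onD[OF dist, of "N + k" N] that by auto
  have colg: "?c (h (N + k)) = odd (N + k)" if "k < t" for k
    using col neq that by (cases "k = 0") auto
  obtain a b where ab: "a \<in> V" "b \<in> V" "(?g, a) \<in> E" "(b, ?g) \<in> E" "?c a = even N" "?c b = even N"
    and path: "(a, b) \<in> (Restr E {v \<in> V - {?g}. ?c v = even N})\<^sup>*"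
    by (rule hole_path[OF hole, of "even N"])
  have a: "a = h (N + (p + 1))"
  proof (rule hole_neighbours_unique(1)[OF hole])
    show "?c a = ?c (h (N + (p + 1)))" using colg[of "p + 1"] p ab by simp
  qed (use ab h_in_V walk_edge[of "N + p"] in auto)
  have b: "b = h (N + (p - 1))"
  proof (rule hole_neighbours_unique(2)[OF hole])
    show "?c b = ?c (h (N + (p - 1)))" using colg[of "p - 1"] p ab by (simp add: even_diff_nat)
    show "(h (N + (p - 1)), ?g) \<in> E" using walk_edge[of "N + (p - 1)"] p by simp
  qed (use ab h_in_V in auto)
  have "\<exists>k. odd k \<and> p < k \<and> k < t \<and> y = h (N + k)"
    if "(a, y) \<in> (Restr E {v \<in> V - {?g}. ?c v = even N})\<^sup>*" for y
    using that
  proof (induction rule: rtrancl_induct)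
    case base
    then show ?case using a p by (intro exI[of _ "p + 1"]) auto
  next
    case (step y z)
    then obtain k where k: "odd k" "p < k" "k < t" "y = h (N + k)" by blast
    have z: "(h (N + k), z) \<in> E" "z \<in> V" "?c z = even N" using step(2) k by auto
    obtain q where q: "even q" "2 \<le> q" "q + 3 \<le> t"
      "z = h (Suc (N + k)) \<or> z = h (N + k + q)"
      using first_return_structure(3)[OF rN[of k]] z by blast
    have k1: "Suc k < t" using k odd by (metis Suc_lessI even_Suc)
    have "z \<noteq> h (Suc (N + k))" using colg[of "Suc k"] k1 k z by auto
    then have zq: "z = h (N + (k + q))" using q by (simp add: add.assoc)
    show ?case
    proof (cases "k + q < t")
      case True
      then show ?thesis using zq k q by (intro exI[of _ "k + q"]) auto
    next
      case False
      \<comment> \<open>A chord reaching \<open>h N\<close> or passing it ends at an even position, which has the wrong colour.\<close>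
      then have "z = h (N + (k + q - t))" using zq period[of "k + q - t"] by simp
      moreover have "k + q - t < t" "even (k + q - t)" using k q False odd by auto
      ultimately show ?thesis using colg[of "k + q - t"] z by simp
    qed
  qed
  from this[OF path] obtain k where k: "odd k" "p < k" "k < t" "b = h (N + k)" by blast
  then have "N + k = N + (p - 1)"
    using b p by (intro inj_onD[OF dist]) auto
  then show False using k by linarith
qed

end

lemma (in uncolourable_oriented) hole_walk_exists:
  assumes "hole h0 c0"
  shows "\<exists>h c. alternating_hole_walk E V h c"
proof -
  have "\<exists>f. \<forall>n. hole (fst (f n)) (snd (f n)) \<and>
      ((fst (f n), fst (f (Suc n))) \<in> E \<and> snd (f n) (fst (f (Suc n))) = even n \<and>
       snd (f (Suc n)) = (snd (f n))(fst (f n) := even n))"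
  proof (rule dependent_nat_choice)
    show "\<exists>x. hole (fst x) (snd x)" using assms by (intro exI[of _ "(h0, c0)"]) simp
    fix x and n :: nat assume x: "hole (fst x) (snd x)"
    obtain a where a: "a \<in> V" "(fst x, a) \<in> E" "snd x a = even n"
      by (rule hole_path[OF x, of "even n"])
    then show "\<exists>y. hole (fst y) (snd y) \<and> (fst x, fst y) \<in> E \<and> snd x (fst y) = even n \<and>
        snd y = (snd x)(fst x := even n)"
      using hole_move[OF x a(1,2)] by (intro exI[of _ "(a, (snd x)(fst x := even n))"]) simp
  qed
  then obtain f where "\<And>n. hole (fst (f n)) (snd (f n)) \<and>
      ((fst (f n), fst (f (Suc n))) \<in> E \<and> snd (f n) (fst (f (Suc n))) = even n \<and>
       snd (f (Suc n)) = (snd (f n))(fst (f n) := even n))" by blast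
  then have "alternating_hole_walk E V (\<lambda>n. fst (f n)) (\<lambda>n. snd (f n))"
    by unfold_locales auto
  then show ?thesis by blast
qed

text \<open>
  In a minimal counterexample every vertex can serve as the hole where the walk starts.
\<close>
lemma acyclic_two_colouring_if_degree_le_4:
  assumes "finite V" and oriented: "\<And>u v. (u, v) \<in> E \<Longrightarrow> (v, u) \<notin> E"
    and "\<And>v. v \<in> V \<Longrightarrow> degree_in E V v \<le> 4"
  shows "\<exists>c :: 'a \<Rightarrow> bool. acyclic_colouring E V c"
  using assms(1,3)
proof (induction V rule: finite_psubset_induct)
  case (psubset V)
  show ?case
  proof (rule ccontr)
    assume no: "\<not> ?thesis"
    then interpret uncolourable_oriented E V
      by unfold_locales (use psubset.hyps psubset.prems oriented no in blast)+
    have "V \<noteq> {}" using no by (auto simp: acyclic_colouring_def acyclic_def)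
    then obtain v where v: "v \<in> V" by blast
    have "degree_in E (V - {v}) u \<le> 4" if "u \<in> V - {v}" for u
      using degree_in_mono[of V "V - {v}" E u] degree_le_4[of u] finite_V that by auto
    then obtain c :: "'a \<Rightarrow> bool" where "acyclic_colouring E (V - {v}) c"
      using psubset.IH[of "V - {v}"] v by blast
    then have "hole v c" using v by (simp add: hole_def)
    then obtain h c' where "alternating_hole_walk E V h c'" using hole_walk_exists by blast
    then show False by (rule alternating_hole_walk.walk_impossible)
  qed
qed


section \<open>Splitting a vertex set by degrees\<close>

text \<open>
  Lovasz's argument: choose \<open>A\<close> so that the number of edges inside \<open>A\<close> and inside its complement \<open>B\<close>
  plus the weight \<open>t * card A + s * card B\<close> is least. Moving \<open>v\<close> from \<open>A\<close> to \<open>B\<close> changes this quantity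
  by \<open>deg\<^sub>B v - deg\<^sub>A v + s - t\<close>. If \<open>deg\<^sub>A v \<ge> s\<close>, then \<open>deg\<^sub>B v \<le> t - 1\<close>, as the two degrees add up
  to less than \<open>s + t\<close>, and the change would be negative. The weights make the same computation work
  for moves from \<open>B\<close> to \<open>A\<close>.
\<close>
lemma degree_split:
  assumes fin: "finite V" and deg: "\<And>v. v \<in> V \<Longrightarrow> degree_in E V v < s + t"
    and irr: "\<And>v. (v, v) \<notin> E"
  shows "\<exists>A\<subseteq>V. (\<forall>v\<in>A. degree_in E A v < s) \<and> (\<forall>v\<in>V - A. degree_in E (V - A) v < t)"
proof -
  define f where "f A B = card (Restr E A) + card (Restr E B) + t * card A + s * card B" for A B
  have insert: "card (Restr E (insert v S)) = card (Restr E S) + degree_in E S v"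
    if S: "S \<subseteq> V" "v \<notin> S" for S v
  proof -
    have fS: "finite S" using S fin finite_subset by blast
    have "Restr E (insert v S) =
      Restr E S \<union> ((Pair v ` (S \<inter> E `` {v})) \<union> ((\<lambda>u. (u, v)) ` (S \<inter> E\<inverse> `` {v})))"
      using irr by auto
    moreover have "card \<dots> = card (Restr E S) +
        (card (Pair v ` (S \<inter> E `` {v})) + card ((\<lambda>u. (u, v)) ` (S \<inter> E\<inverse> `` {v})))"
      using fS S by (subst card_Un_disjoint, simp, simp, force, subst card_Un_disjoint) auto
    ultimately show ?thesis
      by (simp add: degree_in_def card_image inj_on_def)
  qed
  have move: "f A (insert v B) + degree_in E A v + t = f (insert v A) B + degree_in E B v + s"
    if "A \<subseteq> V" "B \<subseteq> V" "v \<notin> A" "v \<notin> B" for A B v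
    using that insert[of A v] insert[of B v] fin finite_subset[of _ V]
    by (simp add: f_def)
  obtain A where A: "A \<subseteq> V" and min: "\<And>B. B \<subseteq> V \<Longrightarrow> f A (V - A) \<le> f B (V - B)"
    using ex_has_least_nat[of "\<lambda>A. A \<subseteq> V" V "\<lambda>A. f A (V - A)"] by blast
  have total: "degree_in E X v + degree_in E Y v < s + t"
    if "X \<inter> Y = {}" "insert v (X \<union> Y) = V" for X Y v
  proof -
    have "finite X" "finite Y" using that fin by (metis finite_Un finite_insert)+
    then have "degree_in E X v + degree_in E Y v = degree_in E (X \<union> Y) v"
      using that degree_in_disjoint_Un by metis
    also have "\<dots> \<le> degree_in E V v" using that fin by (intro degree_in_mono) auto
    also have "\<dots> < s + t" using that deg by blast
    finally show ?thesis .
  qed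
  \<comment> \<open>Without loops a vertex does not contribute to its own degree, so it may count as outside the part.\<close>
  have self: "degree_in E S v = degree_in E (S - {v}) v" for S v
    unfolding degree_in_def using irr by (intro arg_cong2[where f = "(+)"] arg_cong[where f = card]) auto
  have "degree_in E A v < s" if v: "v \<in> A" for v
  proof -
    have "f (A - {v}) (insert v (V - A)) + degree_in E (A - {v}) v + t
        = f A (V - A) + degree_in E (V - A) v + s"
      using move[of "A - {v}" "V - A" v] A v by (auto simp: insert_absorb)
    moreover have "V - (A - {v}) = insert v (V - A)" using A v by auto
    then have "f A (V - A) \<le> f (A - {v}) (insert v (V - A))"
      using min[of "A - {v}"] A by auto
    moreover have "degree_in E (A - {v}) v + degree_in E (V - A) v < s + t"
      using A v by (intro total) auto
    ultimately show ?thesis using self[of A v] by linarith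
  qed
  moreover have "degree_in E (V - A) v < t" if v: "v \<in> V - A" for v
  proof -
    have "f A (insert v (V - A - {v})) + degree_in E A v + t
        = f (insert v A) (V - A - {v}) + degree_in E (V - A - {v}) v + s"
      using A v by (intro move) auto
    moreover have "insert v (V - A - {v}) = V - A" "V - insert v A = V - A - {v}" using v by auto
    moreover have "f A (V - A) \<le> f (insert v A) (V - insert v A)"
      using min[of "insert v A"] A v by auto
    moreover have "degree_in E A v + degree_in E (V - A - {v}) v < s + t"
      using A v by (intro total) auto
    ultimately show ?thesis using self[of "V - A" v] by simp
  qed
  ultimately show ?thesis using A by blast
qed

text \<open>A vertex on a cycle has an edge in and an edge out inside the set.\<close>
lemma acyclic_if_degree_less_2:
  assumes "finite V" "\<And>v. v \<in> V \<Longrightarrow> degree_in E V v < 2"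
  shows "acyclic (Restr E V)"
proof (rule acyclicI, rule allI, rule notI)
  fix x assume x: "(x, x) \<in> (Restr E V)\<^sup>+"
  then obtain y z where "(x, y) \<in> Restr E V" "(z, x) \<in> Restr E V"
    by (meson tranclD tranclD2)
  then have "V \<inter> E `` {x} \<noteq> {}" "V \<inter> E\<inverse> `` {x} \<noteq> {}" and xV: "x \<in> V" by auto
  then have "0 < card (V \<inter> E `` {x})" "0 < card (V \<inter> E\<inverse> `` {x})"
    using assms(1) by (simp_all add: card_gt_0_iff)
  then show False using assms(2)[OF xV] by (simp add: degree_in_def)
qed

lemma acyclically_colourable_Un:
  assumes "acyclically_colourable E A k" "acyclically_colourable E B l" "A \<inter> B = {}"
  shows "acyclically_colourable E (A \<union> B) (k + l)"
proof -
  obtain c d where c: "c ` A \<subseteq> {..<k}" "acyclic_colouring E A c"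
    and d: "d ` B \<subseteq> {..<l}" "acyclic_colouring E B d"
    using assms unfolding acyclically_colourable_def by blast
  let ?c = "\<lambda>v. if v \<in> A then c v else k + d v"
  have "acyclic (Restr E {v \<in> A \<union> B. ?c v = i})" for i
  proof (cases "i < k")
    case True
    then have "{v \<in> A \<union> B. ?c v = i} = {v \<in> A. c v = i}" by auto
    then show ?thesis using c by (simp add: acyclic_colouring_def)
  next
    case False
    then have "{v \<in> A \<union> B. ?c v = i} \<subseteq> {v \<in> B. d v = i - k}" using c(1) by fastforce
    with d(2) show ?thesis by (rule acyclic_colouring_class)
  qed
  moreover have "?c ` (A \<union> B) \<subseteq> {..<k + l}" using c(1) d(1) by fastforce
  ultimately show ?thesis unfolding acyclically_colourable_def acyclic_colouring_def by blast
qed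

lemma acyclically_colourable_two:
  assumes "acyclic_colouring E V (c :: 'a \<Rightarrow> bool)"
  shows "acyclically_colourable E V 2"
proof -
  let ?d = "\<lambda>v. if c v then 0 else 1 :: nat"
  have "acyclic (Restr E {v \<in> V. ?d v = i})" for i
  proof -
    have "{v \<in> V. ?d v = i} \<subseteq> {v \<in> V. c v = (i = 0)}" by auto
    with assms show ?thesis by (rule acyclic_colouring_class)
  qed
  then have "acyclic_colouring E V ?d" by (simp add: acyclic_colouring_def)
  moreover have "?d ` V \<subseteq> {..<2}" by auto
  ultimately show ?thesis unfolding acyclically_colourable_def by blast
qed

lemma acyclically_colourable_mono:
  "acyclically_colourable E V k \<Longrightarrow> k \<le> l \<Longrightarrow> acyclically_colourable E V l"
  unfolding acyclically_colourable_def by (meson lessThan_subset_iff subset_trans)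

text \<open>
  The term \<open>2 * n div 5\<close> grows by exactly 2 when \<open>n\<close> grows by 5, which pays for the two colours of the
  part split off; for \<open>n \<le> 5\<close> the bound is 1 up to \<open>n = 2\<close> and at least 2 from \<open>n = 3\<close>.
\<close>
lemma acyclically_colourable_if_degree_less:
  assumes "finite V" and oriented: "\<And>u v. (u, v) \<in> E \<Longrightarrow> (v, u) \<notin> E"
    and "\<And>v. v \<in> V \<Longrightarrow> degree_in E V v < n"
  shows "acyclically_colourable E V (2 * n div 5 + 1)"
  using assms(1,3)
proof (induction n arbitrary: V rule: less_induct)
  case (less n)
  have irr: "(v, v) \<notin> E" for v using oriented by blast
  consider "n \<le> 2" | "3 \<le> n" "n \<le> 5" | "5 < n" by linarith
  then show ?case
  proof cases
    case 1
    have "acyclic (Restr E V)"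
      using less.prems 1 by (intro acyclic_if_degree_less_2) (auto intro: less_le_trans)
    then have "acyclic_colouring E V (\<lambda>_. 0 :: nat)"
      by (auto simp: acyclic_colouring_def intro: acyclic_Restr_subset)
    then show ?thesis unfolding acyclically_colourable_def by fastforce
  next
    case 2
    have "degree_in E V v \<le> 4" if "v \<in> V" for v using less.prems(2)[OF that] 2 by linarith
    then obtain c :: "'a \<Rightarrow> bool" where "acyclic_colouring E V c"
      using acyclic_two_colouring_if_degree_le_4[OF less.prems(1) oriented] by blast
    then have "acyclically_colourable E V 2" by (rule acyclically_colourable_two)
    then show ?thesis by (rule acyclically_colourable_mono) (use 2 in linarith)
  next
    case 3
    have "degree_in E V v < 5 + (n - 5)" if "v \<in> V" for v using less.prems(2)[OF that] 3 by simp
    from degree_split[OF less.prems(1) this irr]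
    obtain A where A: "A \<subseteq> V" "\<forall>v\<in>A. degree_in E A v < 5"
      "\<forall>v\<in>V - A. degree_in E (V - A) v < n - 5" by blast
    have fin: "finite A" "finite (V - A)" using A less.prems(1) finite_subset by auto
    have "degree_in E A v \<le> 4" if "v \<in> A" for v using A(2) that by fastforce
    then obtain c :: "'a \<Rightarrow> bool" where "acyclic_colouring E A c"
      using acyclic_two_colouring_if_degree_le_4[OF fin(1) oriented] by blast
    then have "acyclically_colourable E A 2" by (rule acyclically_colourable_two)
    moreover have "acyclically_colourable E (V - A) (2 * (n - 5) div 5 + 1)"
      using A(3) 3 fin by (intro less.IH) auto
    ultimately have "acyclically_colourable E (A \<union> (V - A)) (2 + (2 * (n - 5) div 5 + 1))"
      by (rule acyclically_colourable_Un) auto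
    moreover have "A \<union> (V - A) = V" using A by blast
    moreover have "2 + (2 * (n - 5) div 5 + 1) = 2 * n div 5 + 1" using 3 by linarith
    ultimately show ?thesis by simp
  qed
qed


section \<open>Oriented graphs\<close>

lemma (in wf_digraph) acyclic_set_if_acyclic_Restr:
  assumes S: "S \<subseteq> verts G" and ac: "acyclic (Restr (arcs_ends G) S)"
  shows "acyclic_set G S"
proof -
  interpret H: wf_digraph "G \<restriction> S" by (rule wellformed_induce_subgraph)
  have sub: "arcs_ends (G \<restriction> S) \<subseteq> Restr (arcs_ends G) S"
    by (auto simp: arcs_ends_def arc_to_ends_def)
  have "\<not> H.cycle p" for p
  proof
    assume "H.cycle p"
    then obtain u where "H.awalk u p u" "p \<noteq> []" unfolding H.cycle_def by blast
    then have "u \<rightarrow>\<^sup>+\<^bsub>G \<restriction> S\<^esub> u" using H.reachable1_awalk by blast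
    then have "(u, u) \<in> (Restr (arcs_ends G) S)\<^sup>+" using sub trancl_mono by blast
    then show False using ac by (simp add: acyclic_def)
  qed
  then show ?thesis using S by (simp add: acyclic_set_def)
qed

text \<open>
  The colour classes indexed by colours that occur are nonempty, as the parts of a partition must be.
\<close>
lemma (in digraph) chromatic_number_le_if_colourable:
  assumes "acyclically_colourable (arcs_ends G) (verts G) k"
  shows "digraph_chromatic_number G \<le> k"
proof -
  obtain c where c: "c ` verts G \<subseteq> {..<k}" "acyclic_colouring (arcs_ends G) (verts G) c"
    using assms unfolding acyclically_colourable_def by blast
  define cls where "cls i = {v \<in> verts G. c v = i}" for i
  let ?P = "cls ` c ` verts G"
  have "partition_on (verts G) ?P"
    by (rule partition_onI) (auto simp: cls_def disjnt_def)
  moreover have "acyclic_set G S" if "S \<in> ?P" for S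
    using that c(2) by (auto simp: cls_def acyclic_colouring_def intro!: acyclic_set_if_acyclic_Restr)
  ultimately have "acyclic_partition G ?P" by (simp add: acyclic_partition_def)
  moreover have "finite ?P" by simp
  ultimately have "digraph_chromatic_number G \<le> card ?P"
    unfolding digraph_chromatic_number_def by (intro Least_le) blast
  also have "\<dots> \<le> card (c ` verts G)" by (rule card_image_le) simp
  also have "\<dots> \<le> card {..<k}" using c(1) by (rule card_mono[rotated]) simp
  finally show ?thesis by simp
qed

lemma (in fin_digraph) degree_in_le_total_degree:
  "degree_in (arcs_ends G) (verts G) v \<le> in_degree G v + out_degree G v"
proof -
  have "verts G \<inter> arcs_ends G `` {v} \<subseteq> head G ` out_arcs G v"
    "verts G \<inter> (arcs_ends G)\<inverse> `` {v} \<subseteq> tail G ` in_arcs G v"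
    by (auto simp: arcs_ends_def arc_to_ends_def)
  then have "card (verts G \<inter> arcs_ends G `` {v}) \<le> out_degree G v"
    "card (verts G \<inter> (arcs_ends G)\<inverse> `` {v}) \<le> in_degree G v"
    unfolding out_degree_def in_degree_def
    by (meson surj_card_le finite_out_arcs finite_in_arcs)+
  then show ?thesis by (simp add: degree_in_def)
qed

theorem corollary1p4:
  fixes D :: "('a, 'b) pre_digraph"
  assumes "oriented_graph D"
  shows "int (digraph_chromatic_number D) \<le> \<lfloor>(2 / 5 :: real) * (real (max_total_degree D) + 1)\<rfloor> + 1"
proof -
  interpret oriented_graph D by (rule assms)
  let ?n = "max_total_degree D + 1"
  have "degree_in (arcs_ends D) (verts D) v < ?n" if "v \<in> verts D" for v
  proof -
    have "in_degree D v + out_degree D v \<le> max_total_degree D"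
      unfolding max_total_degree_def using that by (intro Max_ge) auto
    then show ?thesis using degree_in_le_total_degree[of v] by linarith
  qed
  moreover have "(v, u) \<notin> arcs_ends D" if "(u, v) \<in> arcs_ends D" for u v
  proof
    assume "(v, u) \<in> arcs_ends D"
    with that obtain e f where e: "e \<in> arcs D" "tail D e = u" "head D e = v"
      and f: "f \<in> arcs D" "tail D f = v" "head D f = u"
      by (auto simp: arcs_ends_def arc_to_ends_def)
    then have "e = f" by (intro at_most_one_arc) auto
    then show False using e f no_loops by metis
  qed
  ultimately have "acyclically_colourable (arcs_ends D) (verts D) (2 * ?n div 5 + 1)"
    by (intro acyclically_colourable_if_degree_less) auto
  then have "digraph_chromatic_number D \<le> 2 * ?n div 5 + 1"
    by (rule chromatic_number_le_if_colourable)
  moreover have "\<lfloor>(2 / 5 :: real) * (real (max_total_degree D) + 1)\<rfloor> = int (2 * ?n div 5)"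
    using floor_divide_of_nat_eq[of "2 * ?n" 5, where ?'a = real] by (simp add: algebra_simps)
  ultimately show ?thesis by simp
qed

end
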